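(* (i) If $\mathcal{H}$ is a 3-uniform hypergraph on $n$ vertices without isolated vertices, then $\gamma_g'(\mathcal{H})\le \frac{5}{9}n$. (ii) If $G$ is a graph of order $n$ without isolated vertices in which every edge belongs to a triangle, then $\gamma_g'(G)\le \frac{5}{9}n$.
   Context: Hypergraphs and graphs are finite. In a hypergraph (or graph), two distinct vertices are adjacent if some edge contains both; $N[v]$ is $v$ together with all vertices adjacent to $v$, and $N[S]=\bigcup_{v\in S}N[v]$. The domination game: Dominator and Staller alternately choose vertices $v_1,v_2,\dots$; with $D_i=\{v_1,\dots,v_i\}$, each chosen vertex must satisfy $N[v_i]\setminus N[D_{i-1}]\ne\emptyset$, and the game ends when $N[D_d]$ is the whole vertex set. Dominator aims to minimize the number of moves, Staller to maximize it. $\gamma_g'$ denotes the number of moves under optimal play when Staller makes the first move. *)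

theory Defs
  imports Complex_Main
begin

definition hypergraph :: "'a set \<Rightarrow> 'a set set \<Rightarrow> bool" where
  "hypergraph V E \<longleftrightarrow> finite V \<and> (\<forall>e\<in>E. e \<subseteq> V)"

definition uniform :: "nat \<Rightarrow> 'a set set \<Rightarrow> bool" where
  "uniform k E \<longleftrightarrow> (\<forall>e\<in>E. card e = k)"

definition graph :: "'a set \<Rightarrow> 'a set set \<Rightarrow> bool" where
  "graph V E \<longleftrightarrow> hypergraph V E \<and> uniform 2 E"

definition no_isolated :: "'a set \<Rightarrow> 'a set set \<Rightarrow> bool" where
  "no_isolated V E \<longleftrightarrow> (\<forall>v\<in>V. \<exists>e\<in>E. v \<in> e)"

definition every_edge_in_triangle :: "'a set set \<Rightarrow> bool" where
  "every_edge_in_triangle E \<longleftrightarrow>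
     (\<forall>e\<in>E. \<exists>x y z. e = {x, y} \<and> {x, z} \<in> E \<and> {y, z} \<in> E)"

definition cnbhd :: "'a set set \<Rightarrow> 'a \<Rightarrow> 'a set" where
  "cnbhd E v = insert v {u. \<exists>e\<in>E. v \<in> e \<and> u \<in> e}"

text \<open>Value of the domination game from a position where the set S = N[D] is already
  dominated; dom_turn = True means Dominator moves next.  The fuel argument k bounds the
  number of remaining moves; since every legal move dominates a new vertex of V,
  fuel card V suffices from the start (S = {}).\<close>
fun game_val :: "'a set \<Rightarrow> 'a set set \<Rightarrow> nat \<Rightarrow> bool \<Rightarrow> 'a set \<Rightarrow> nat" where
  "game_val V E 0 dom_turn S = 0"
| "game_val V E (Suc k) dom_turn S =
     (if V \<subseteq> S then 0
      else if dom_turn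
        then Min {1 + game_val V E k False (S \<union> cnbhd E v) | v. v \<in> V \<and> \<not> cnbhd E v \<subseteq> S}
        else Max {1 + game_val V E k True (S \<union> cnbhd E v) | v. v \<in> V \<and> \<not> cnbhd E v \<subseteq> S})"

definition game_dom_S :: "'a set \<Rightarrow> 'a set set \<Rightarrow> nat" where
  "game_dom_S V E = game_val V E (card V) False {}"

end

theory Submission
  imports Defs
begin

text \<open>
  Both statements only use that every vertex has a neighbour and that any two adjacent vertices
  have a common neighbour.  Call a vertex white while it is undominated, and let its degree be the
  number of white vertices in its closed neighbourhood.  A white vertex has weight 20, a nonwhite
  vertex of degree d has weight b(d), and the potential is the total weight, initially 20n.  It
  suffices that the potential drops by 36 per move on average.

  Staller may gain as little as 16, but Dominator, playing greedily, can always raise the gain of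
  the round to 72.  While some degree is at least 5 this works for the weights
  b = 10, 11, 12, 13, 14, 14, ..., afterwards for the smaller weights b = 8, 10, 12, 13, 14, 14, ....
  The only exception is a position in which the closed neighbourhoods meet the white set in pairwise
  equal or disjoint sets; from there on every move gains at least 36.  When such a position arises
  by a move of Staller, and all degrees are at most 2, that move has gained at least 20, so at most
  16 units are missing in total.  These are recovered in the first round, which gains at least 88
  because all degrees are still at least 3.
\<close>

section \<open>Weights of nonwhite vertices\<close>

definition early_weight :: "nat \<Rightarrow> int" where
  "early_weight d = (if d = 0 then 0 else 9 + min (int d) 5)"

definition late_weight :: "nat \<Rightarrow> int" where
  "late_weight d =
     (if d = 0 then 0 else if d \<le> 3 then 6 + 2 * int d else if d = 4 then 13 else 14)"

text \<open>The cap 14 makes a white vertex, of weight 20, lose at least 6 when it is dominated;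
  monotonicity makes every other change of weight a loss.\<close>

definition admissible :: "(nat \<Rightarrow> int) \<Rightarrow> bool" where
  "admissible b \<longleftrightarrow> b 0 = 0 \<and> mono b \<and> (\<forall>d. b d \<le> 14)"

lemma admissible_early: "admissible early_weight"
  by (auto simp: admissible_def early_weight_def mono_def)

lemma admissible_late: "admissible late_weight"
  by (auto simp: admissible_def late_weight_def mono_def)

lemma late_le_early: "late_weight d \<le> early_weight d"
  by (auto simp: early_weight_def late_weight_def)

lemma obtain_three_distinct:
  assumes "card A = 3" "v \<in> A"
  obtains x y where "A = {v, x, y}" "x \<noteq> v" "y \<noteq> v" "x \<noteq> y"
proof -
  have "card (A - {v}) = 2" using assms by (simp add: card_Diff_singleton_if)
  then obtain x y where "A - {v} = {x, y}" "x \<noteq> y" by (auto simp: card_2_iff)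
  then show ?thesis using assms(2) that[of x y] by blast
qed

section \<open>Closed neighbourhoods, potential and gain\<close>

locale triangle_nbhd =
  fixes V :: "'a set" and N :: "'a \<Rightarrow> 'a set"
  assumes fin: "finite V"
    and sub: "v \<in> V \<Longrightarrow> N v \<subseteq> V"
    and self: "v \<in> N v"
    and sym: "u \<in> N v \<Longrightarrow> v \<in> N u"
    and nbr: "v \<in> V \<Longrightarrow> \<exists>u\<in>N v. u \<noteq> v"
    and tri: "v \<in> V \<Longrightarrow> u \<in> N v \<Longrightarrow> u \<noteq> v \<Longrightarrow> \<exists>r. r \<in> N u \<and> r \<in> N v \<and> r \<noteq> u \<and> r \<noteq> v"
begin

definition weight :: "(nat \<Rightarrow> int) \<Rightarrow> 'a set \<Rightarrow> 'a \<Rightarrow> int" where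
  "weight b W x = (if x \<in> W then 20 else b (card (N x \<inter> W)))"

definition pot :: "(nat \<Rightarrow> int) \<Rightarrow> 'a set \<Rightarrow> int" where
  "pot b W = (\<Sum>x\<in>V. weight b W x)"

definition gain :: "(nat \<Rightarrow> int) \<Rightarrow> 'a set \<Rightarrow> 'a \<Rightarrow> int" where
  "gain b W v = pot b W - pot b (W - N v)"

text \<open>The vertex itself is counted, since neighbourhoods are closed.\<close>
definition max_deg :: "'a set \<Rightarrow> nat \<Rightarrow> bool" where
  "max_deg W k \<longleftrightarrow> (\<forall>x\<in>V. card (N x \<inter> W) \<le> k)"

lemma max_degD: "max_deg W k \<Longrightarrow> x \<in> V \<Longrightarrow> card (N x \<inter> W) \<le> k"
  by (simp add: max_deg_def)

lemma finN: "v \<in> V \<Longrightarrow> finite (N v)"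
  using fin sub finite_subset by blast

lemma card_N_ge_3:
  assumes "v \<in> V"
  shows "3 \<le> card (N v)"
proof -
  obtain u where u: "u \<in> N v" "u \<noteq> v" using nbr assms by blast
  obtain r where r: "r \<in> N u" "r \<in> N v" "r \<noteq> u" "r \<noteq> v" using tri assms u by blast
  have "card {v, u, r} \<le> card (N v)"
    using u r self by (intro card_mono finN assms) auto
  then show ?thesis using u r by simp
qed

lemma weight_antimono:
  assumes b: "admissible b" and W: "W \<subseteq> V" and x: "x \<in> V" and U: "U \<subseteq> W"
  shows "weight b U x \<le> weight b W x"
proof -
  have m: "mono b" "\<And>d. b d \<le> 14" using b by (auto simp: admissible_def)
  have "card (N x \<inter> U) \<le> card (N x \<inter> W)"
    using U finN[OF x] by (intro card_mono) auto
  then have "b (card (N x \<inter> U)) \<le> b (card (N x \<inter> W))" using m(1) by (simp add: mono_def)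
  moreover have "b (card (N x \<inter> U)) \<le> 20" using m(2)[of "card (N x \<inter> U)"] by simp
  ultimately show ?thesis using U by (auto simp: weight_def)
qed

section \<open>Lower bounds for the gain of a move\<close>

text \<open>No vertex gains weight in a move, so the losses outside \<open>T\<close> may be
  dropped.\<close>

lemma gain_ge_sum:
  assumes b: "admissible b" and W: "W \<subseteq> V" and T: "T \<subseteq> V"
  shows "(\<Sum>x\<in>T. weight b W x - weight b (W - N v) x) \<le> gain b W v"
proof -
  have "(\<Sum>x\<in>T. weight b W x - weight b (W - N v) x)
      \<le> (\<Sum>x\<in>V. weight b W x - weight b (W - N v) x)"
    using weight_antimono[OF b W] T fin by (intro sum_mono2) auto
  then show ?thesis by (simp add: gain_def pot_def sum_subtractf)
qed

text \<open>No white vertex is left in \<open>N v\<close>, so \<open>v\<close> loses its whole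
  weight; a white neighbour falls from 20 to \<open>b\<close> of its new degree. The set
  \<open>X\<close> collects the nonwhite vertices whose loss is also to be counted.\<close>

lemma gain_ge:
  assumes b: "admissible b" and W: "W \<subseteq> V" and v: "v \<in> V"
    and X: "X \<subseteq> V - W - {v}"
  shows "weight b W v
     + (\<Sum>u\<in>N v \<inter> W - {v}. 20 - b (card (N u \<inter> (W - N v))))
     + (\<Sum>x\<in>X. b (card (N x \<inter> W)) - b (card (N x \<inter> (W - N v)))) \<le> gain b W v"
proof -
  let ?D = "\<lambda>x. weight b W x - weight b (W - N v) x"
  let ?A = "N v \<inter> W - {v}"
  have f: "finite ?A" "finite X" using finN[OF v] X fin finite_subset by blast+
  have 0: "weight b (W - N v) v = 0"
  proof -
    have "N v \<inter> (W - N v) = {}" "v \<notin> W - N v" using self by auto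
    then show ?thesis using b by (simp add: weight_def admissible_def)
  qed
  have "sum ?D ({v} \<union> (?A \<union> X)) = ?D v + (sum ?D ?A + sum ?D X)"
  proof -
    have "?A \<inter> X = {}" "v \<notin> ?A \<union> X" using X by auto
    then show ?thesis using f by (simp add: sum.union_disjoint)
  qed
  also have "sum ?D ?A = (\<Sum>u\<in>?A. 20 - b (card (N u \<inter> (W - N v))))"
    by (intro sum.cong) (auto simp: weight_def)
  also have "sum ?D X = (\<Sum>x\<in>X. b (card (N x \<inter> W)) - b (card (N x \<inter> (W - N v))))"
    using X by (intro sum.cong) (auto simp: weight_def)
  finally show ?thesis
    using gain_ge_sum[OF b W, of "{v} \<union> (?A \<union> X)" v] X v W 0 by (auto simp: algebra_simps)
qed

lemma double_count:
  assumes "finite X" "finite Y"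
  shows "(\<Sum>x\<in>X. card (N x \<inter> Y)) = (\<Sum>u\<in>Y. card (N u \<inter> X))"
proof -
  have 1: "card (N x \<inter> Z) = (\<Sum>u\<in>Z. of_bool (u \<in> N x))" if "finite Z" for x Z
    using that by (simp add: Int_commute of_bool_def sum.If_cases Int_def)
  have "(\<Sum>x\<in>X. card (N x \<inter> Y)) = (\<Sum>x\<in>X. \<Sum>u\<in>Y. of_bool (u \<in> N x))"
    using 1 assms by simp
  also have "\<dots> = (\<Sum>u\<in>Y. \<Sum>x\<in>X. of_bool (x \<in> N u))"
    using sym by (subst sum.swap) (intro sum.cong refl, auto simp: of_bool_def)
  finally show ?thesis using 1 assms by simp
qed

text \<open>Discharging: each vertex of \<open>X\<close> passes \<open>c\<close> units of its loss
  to every neighbour in \<open>N v \<inter> W - {v}\<close>, which it can afford by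
  \<open>drop\<close>. By double counting, each of these white neighbours then accounts for at least
  \<open>g\<close>.\<close>

lemma gain_ge_uniform:
  fixes c g :: int
  assumes b: "admissible b" and W: "W \<subseteq> V" and v: "v \<in> V"
    and X: "X \<subseteq> V - W - {v}"
    and drop: "\<And>x. x \<in> X \<Longrightarrow> c * int (card (N x \<inter> (N v \<inter> W - {v})))
                  \<le> b (card (N x \<inter> W)) - b (card (N x \<inter> (W - N v)))"
    and g: "\<And>u. u \<in> N v \<inter> W - {v} \<Longrightarrow>
                  g \<le> 20 - b (card (N u \<inter> (W - N v))) + c * int (card (N u \<inter> X))"
  shows "weight b W v + int (card (N v \<inter> W - {v})) * g \<le> gain b W v"
proof -
  let ?A = "N v \<inter> W - {v}"
  have f: "finite ?A" "finite X" using finN[OF v] X fin finite_subset by blast+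
  have "int (card ?A) * g
      \<le> (\<Sum>u\<in>?A. 20 - b (card (N u \<inter> (W - N v))) + c * int (card (N u \<inter> X)))"
    using sum_mono[of ?A "\<lambda>_. g", OF g] by simp
  also have "\<dots> = (\<Sum>u\<in>?A. 20 - b (card (N u \<inter> (W - N v)))) + c * int (\<Sum>u\<in>?A. card (N u \<inter> X))"
    by (simp add: sum.distrib sum_distrib_left)
  also have "(\<Sum>u\<in>?A. card (N u \<inter> X)) = (\<Sum>x\<in>X. card (N x \<inter> ?A))"
    using double_count f by metis
  also have "c * int (\<Sum>x\<in>X. card (N x \<inter> ?A))
      \<le> (\<Sum>x\<in>X. b (card (N x \<inter> W)) - b (card (N x \<inter> (W - N v))))"
    using drop by (simp add: sum_distrib_left sum_mono)
  finally show ?thesis using gain_ge[OF b W v X] by linarith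
qed

lemma card_after:
  assumes "x \<in> V"
  shows "card (N x \<inter> (W - N v)) = card (N x \<inter> W) - card (N x \<inter> (N v \<inter> W))"
    and "card (N x \<inter> (N v \<inter> W)) \<le> card (N x \<inter> W)"
proof -
  have "N x \<inter> (W - N v) = (N x \<inter> W) - (N x \<inter> (N v \<inter> W))" by blast
  moreover have "N x \<inter> (N v \<inter> W) \<subseteq> N x \<inter> W" by blast
  ultimately show "card (N x \<inter> (W - N v)) = card (N x \<inter> W) - card (N x \<inter> (N v \<inter> W))"
    using finN[OF assms] card_Diff_subset[of "N x \<inter> (N v \<inter> W)" "N x \<inter> W"] by simp
  show "card (N x \<inter> (N v \<inter> W)) \<le> card (N x \<inter> W)"
    using finN[OF assms] by (intro card_mono) auto
qed

lemma card_after_le: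
  assumes "u \<in> V" "Y \<subseteq> N u \<inter> N v \<inter> W" "card (N u \<inter> W) \<le> k"
  shows "card (N u \<inter> (W - N v)) \<le> k - card Y"
proof -
  have "card Y \<le> card (N u \<inter> (N v \<inter> W))"
    using assms finN by (intro card_mono) auto
  then show ?thesis using card_after(1)[OF assms(1)] assms(3) by simp
qed

lemma gain_legal: "0 < gain b W v \<Longrightarrow> N v \<inter> W \<noteq> {}"
proof
  assume "0 < gain b W v" "N v \<inter> W = {}"
  then have "W - N v = W" by blast
  with \<open>0 < gain b W v\<close> show False by (simp add: gain_def)
qed

text \<open>Each neighbour u of v contributes c more than its degree alone guarantees: the third vertex of a
  triangle on u and v is either white, which lowers the new degree of u, or nonwhite and loses
  weight itself.\<close>
lemma white_max_gain:
  fixes c :: int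
  assumes b: "admissible b" and W: "W \<subseteq> V" and v: "v \<in> W"
    and k: "card (N v \<inter> W) = k" "3 \<le> k" and mx: "max_deg W k"
    and c: "0 \<le> c" "c \<le> b (k - 2) - b (k - 3)"
    and drop: "\<And>d t. 1 \<le> t \<Longrightarrow> t \<le> d \<Longrightarrow> d \<le> k \<Longrightarrow> c * (int t - 1) \<le> b d - b (d - t)"
  shows "20 + int (k - 1) * (20 - b (k - 2) + c) \<le> gain b W v"
proof -
  have vV: "v \<in> V" using v W by blast
  have m: "mono b" using b by (simp add: admissible_def)
  have "weight b W v + int (card (N v \<inter> W - {v})) * (20 - b (k - 2) + c) \<le> gain b W v"
  proof (rule gain_ge_uniform[OF b W vV, where X = "N v - W" and c = c])
    show "N v - W \<subseteq> V - W - {v}" using sub[OF vV] v by blast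
  next
    fix x assume x: "x \<in> N v - W"
    then have xV: "x \<in> V" using sub[OF vV] by blast
    let ?t = "card (N x \<inter> (N v \<inter> W))"
    have vx: "v \<in> N x \<inter> (N v \<inter> W)" using x sym self v by blast
    have "1 \<le> ?t" using vx finN[OF xV] by (simp add: Suc_le_eq card_gt_0_iff) blast
    \<comment> \<open>Among the \<open>?t\<close> white neighbours that \<open>x\<close> loses,
      \<open>v\<close> receives no charge; hence the \<open>int t - 1\<close> in
      \<open>drop\<close>.\<close>
    moreover have "N x \<inter> (N v \<inter> W - {v}) = N x \<inter> (N v \<inter> W) - {v}" by blast
    then have "card (N x \<inter> (N v \<inter> W - {v})) = ?t - 1"
      using vx finN[OF xV] by (simp add: card_Diff_singleton)
    ultimately show "c * int (card (N x \<inter> (N v \<inter> W - {v})))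
        \<le> b (card (N x \<inter> W)) - b (card (N x \<inter> (W - N v)))"
      using drop[of ?t "card (N x \<inter> W)"] card_after[OF xV] max_degD[OF mx xV]
      by (simp add: of_nat_diff)
  next
    fix u assume u: "u \<in> N v \<inter> W - {v}"
    then have uV: "u \<in> V" and uv: "u \<in> N v" "u \<noteq> v" using W by auto
    obtain r where r: "r \<in> N u" "r \<in> N v" "r \<noteq> u" "r \<noteq> v" using tri[OF vV uv] by blast
    show "20 - b (k - 2) + c
      \<le> 20 - b (card (N u \<inter> (W - N v))) + c * int (card (N u \<inter> (N v - W)))"
    proof (cases "r \<in> W")
      case True
      have "card (N u \<inter> (W - N v)) \<le> k - card {u, v, r}"
        using u r v True self sym max_degD[OF mx uV] by (intro card_after_le uV) auto
      then have "b (card (N u \<inter> (W - N v))) \<le> b (k - 3)" using r u m by (auto simp: mono_def)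
      moreover have "0 \<le> c * int (card (N u \<inter> (N v - W)))" using c by simp
      ultimately show ?thesis using c by linarith
    next
      case False
      have "card (N u \<inter> (W - N v)) \<le> k - card {u, v}"
        using u v self sym max_degD[OF mx uV] by (intro card_after_le uV) auto
      then have "b (card (N u \<inter> (W - N v))) \<le> b (k - 2)" using u m by (auto simp: mono_def)
      moreover have "1 \<le> card (N u \<inter> (N v - W))"
        using r False finN[OF uV] by (simp add: Suc_le_eq card_gt_0_iff) blast
      then have "c * 1 \<le> c * int (card (N u \<inter> (N v - W)))"
        using c by (intro mult_left_mono) auto
      ultimately show ?thesis by linarith
    qed
  qed
  moreover have "card (N v \<inter> W - {v}) = k - 1" using k v self by (simp add: card_Diff_singleton)
  ultimately show ?thesis using v by (simp add: weight_def)
qed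

text \<open>Nonwhite counterpart of \<open>white_max_gain\<close>. A neighbour \<open>u\<close> does
  not lose \<open>v\<close> from its degree, but by \<open>white\<close> it starts one lower. So its
  new degree is again at most \<open>k - 2\<close>, and the third vertex of a triangle on
  \<open>u\<close> and \<open>v\<close> either lowers it to \<open>k - 3\<close> or pays
  \<open>c\<close>.\<close>

lemma blue_max_gain:
  fixes c :: int
  assumes b: "admissible b" and W: "W \<subseteq> V" and v: "v \<in> V" "v \<notin> W"
    and k: "card (N v \<inter> W) = k" "3 \<le> k" and mx: "max_deg W k"
    and white: "\<And>u. u \<in> W \<Longrightarrow> card (N u \<inter> W) \<le> k - 1"
    and c: "0 \<le> c" "c \<le> b (k - 2) - b (k - 3)"
    and drop: "\<And>d t. t \<le> d \<Longrightarrow> d \<le> k \<Longrightarrow> c * int t \<le> b d - b (d - t)"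
  shows "b k + int k * (20 - b (k - 2) + c) \<le> gain b W v"
proof -
  have m: "mono b" using b by (simp add: admissible_def)
  have "weight b W v + int (card (N v \<inter> W - {v})) * (20 - b (k - 2) + c) \<le> gain b W v"
  proof (rule gain_ge_uniform[OF b W v(1), where X = "N v - W - {v}" and c = c])
    show "N v - W - {v} \<subseteq> V - W - {v}" using sub[OF v(1)] by blast
  next
    fix x assume x: "x \<in> N v - W - {v}"
    then have xV: "x \<in> V" using sub[OF v(1)] by blast
    have "N x \<inter> (N v \<inter> W - {v}) = N x \<inter> (N v \<inter> W)" using v by blast
    then show "c * int (card (N x \<inter> (N v \<inter> W - {v})))
        \<le> b (card (N x \<inter> W)) - b (card (N x \<inter> (W - N v)))"
      using drop[OF card_after(2)[OF xV] max_degD[OF mx xV]] card_after(1)[OF xV] by simp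
  next
    fix u assume u: "u \<in> N v \<inter> W - {v}"
    then have uV: "u \<in> V" and uv: "u \<in> N v" "u \<noteq> v" and uW: "u \<in> W" using W by auto
    obtain r where r: "r \<in> N u" "r \<in> N v" "r \<noteq> u" "r \<noteq> v" using tri[OF v(1) uv] by blast
    show "20 - b (k - 2) + c
      \<le> 20 - b (card (N u \<inter> (W - N v))) + c * int (card (N u \<inter> (N v - W - {v})))"
    proof (cases "r \<in> W")
      case True
      have "card (N u \<inter> (W - N v)) \<le> (k - 1) - card {u, r}"
        using u r True self white[OF uW] by (intro card_after_le uV) auto
      then have "b (card (N u \<inter> (W - N v))) \<le> b (k - 3)" using r u m by (auto simp: mono_def)
      moreover have "0 \<le> c * int (card (N u \<inter> (N v - W - {v})))" using c by simp
      ultimately show ?thesis using c by linarith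
    next
      case False
      have "card (N u \<inter> (W - N v)) \<le> (k - 1) - card {u}"
        using u self white[OF uW] by (intro card_after_le uV) auto
      then have "card (N u \<inter> (W - N v)) \<le> k - 2" using k by simp
      then have "b (card (N u \<inter> (W - N v))) \<le> b (k - 2)" using m by (auto simp: mono_def)
      moreover have "1 \<le> card (N u \<inter> (N v - W - {v}))"
        using r False finN[OF uV] by (simp add: Suc_le_eq card_gt_0_iff) blast
      then have "c * 1 \<le> c * int (card (N u \<inter> (N v - W - {v})))"
        using c by (intro mult_left_mono) auto
      ultimately show ?thesis by linarith
    qed
  qed
  then show ?thesis using v k by (simp add: weight_def)
qed

lemma gain_ge_crude:
  assumes b: "admissible b" and W: "W \<subseteq> V" and v: "v \<in> V"
    and g: "\<And>u. u \<in> N v \<inter> W - {v} \<Longrightarrow> b (card (N u \<inter> (W - N v))) \<le> B"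
  shows "weight b W v + int (card (N v \<inter> W - {v})) * (20 - B) \<le> gain b W v"
  using g by (intro gain_ge_uniform[OF b W v, where X = "{}" and c = 0]) auto

section \<open>Vertices of maximum degree\<close>

lemma max_deg_attained:
  assumes "x \<in> V" "k \<le> card (N x \<inter> W)"
  obtains v where "v \<in> V" "k \<le> card (N v \<inter> W)" "max_deg W (card (N v \<inter> W))"
proof -
  let ?d = "\<lambda>v. card (N v \<inter> W)"
  have "Max (?d ` V) \<in> ?d ` V" using assms(1) fin by (intro Max_in) auto
  then obtain v where v: "v \<in> V" "?d v = Max (?d ` V)" by force
  then have "max_deg W (?d v)" using fin by (simp add: max_deg_def)
  then show ?thesis using that v assms by (force simp: max_deg_def)
qed

lemma max_deg_cases:
  obtains (5) x where "x \<in> V" "5 \<le> card (N x \<inter> W)"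
  | (4) x where "max_deg W 4" "x \<in> V" "card (N x \<inter> W) = 4"
  | (3) x where "max_deg W 3" "x \<in> V" "card (N x \<inter> W) = 3"
  | (2) "max_deg W 2"
proof (cases "max_deg W 2")
  case False
  then obtain x where "x \<in> V" "3 \<le> card (N x \<inter> W)" by (force simp: max_deg_def)
  then obtain v where v: "v \<in> V" "3 \<le> card (N v \<inter> W)" "max_deg W (card (N v \<inter> W))"
    using max_deg_attained by blast
  then consider "5 \<le> card (N v \<inter> W)" | "card (N v \<inter> W) = 4" | "card (N v \<inter> W) = 3" by linarith
  then show ?thesis using v that by cases auto
qed (use that in blast)

text \<open>Dominator prefers a white vertex of maximum degree; when there is none, the white
  degrees are smaller by one, as \<open>blue_max_gain\<close> requires.\<close>

lemma white_or_blue_max: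
  assumes W: "W \<subseteq> V" and v: "v \<in> V" "card (N v \<inter> W) = k" "0 < k" and mx: "max_deg W k"
  obtains (white) w where "w \<in> W" "card (N w \<inter> W) = k"
  | (blue) "v \<notin> W" "\<And>u. u \<in> W \<Longrightarrow> card (N u \<inter> W) \<le> k - 1"
proof (cases "\<exists>w\<in>W. card (N w \<inter> W) = k")
  case False
  then have "card (N u \<inter> W) \<le> k - 1" if "u \<in> W" for u
    using max_degD[OF mx, of u] W that by (metis Suc_leI Suc_pred' le_neq_implies_less subsetD v(3) Suc_le_mono)
  then show ?thesis using blue False v by blast
qed (use white in blast)

section \<open>Dominator's replies at maximum degree at least 3\<close>

text \<open>The target 56 is 72 minus the 16 that Staller's move is sure to gain.\<close>

lemma reply_deg_ge_5:
  assumes W: "W \<subseteq> V" and x: "x \<in> V" "5 \<le> card (N x \<inter> W)"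
  shows "\<exists>v\<in>V. 56 \<le> gain early_weight W v"
proof -
  note b = admissible_early
  obtain v where v: "v \<in> V" "5 \<le> card (N v \<inter> W)" and mx: "max_deg W (card (N v \<inter> W))"
    using max_deg_attained[OF x] .
  let ?k = "card (N v \<inter> W)"
  consider (7) "7 \<le> ?k" | (w) w where "?k < 7" "w \<in> W" "card (N w \<inter> W) = ?k"
    | (b) "?k < 7" "v \<notin> W" "\<And>u. u \<in> W \<Longrightarrow> card (N u \<inter> W) \<le> ?k - 1"
    using white_or_blue_max[OF W v(1) refl _ mx] v(2) by (metis not_less gr0I not_numeral_le_zero)
  then show ?thesis
  proof cases
    case 7
    \<comment> \<open>From degree 7 on no triangles are needed: 20 + 6 * 6 for a white
      \<open>v\<close> and 14 + 7 * 6 for a nonwhite one are both 56.\<close>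
    have "weight early_weight W v + int (card (N v \<inter> W - {v})) * (20 - 14) \<le> gain early_weight W v"
      using b by (intro gain_ge_crude b W v) (auto simp: admissible_def)
    moreover have "56 \<le> weight early_weight W v + int (card (N v \<inter> W - {v})) * (20 - 14)"
      using 7 v self by (auto simp: weight_def early_weight_def card_Diff_singleton_if)
    ultimately show ?thesis using v by force
  next
    case w
    \<comment> \<open>With \<open>c = 1\<close> the bound is 20 + 4 * 9 = 56 for degree 5 and 20 + 5
      * 8 = 60 for degree 6.\<close>
    have "20 + int (?k - 1) * (20 - early_weight (?k - 2) + 1) \<le> gain early_weight W w"
      using w mx v by (intro white_max_gain b W) (auto simp: early_weight_def)
    moreover have "56 \<le> 20 + int (?k - 1) * (20 - early_weight (?k - 2) + 1)"
    proof -
      have "?k = 5 \<or> ?k = 6" using w v by linarith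
      then show ?thesis by (auto simp: early_weight_def)
    qed
    ultimately have "56 \<le> gain early_weight W w" by linarith
    then show ?thesis using w(2) W by blast
  next
    case b
    \<comment> \<open>For degree 6 nothing can be charged, because a drop from degree 6 to 5 is
      free. The bounds are 14 + 5 * 9 = 59 and 14 + 6 * 7 = 56.\<close>
    define c :: int where "c = (if ?k = 5 then 1 else 0)"
    have "early_weight ?k + int ?k * (20 - early_weight (?k - 2) + c) \<le> gain early_weight W v"
      using b mx v by (intro blue_max_gain admissible_early W) (auto simp: early_weight_def c_def)
    moreover have "56 \<le> early_weight ?k + int ?k * (20 - early_weight (?k - 2) + c)"
    proof -
      have "?k = 5 \<or> ?k = 6" using b v by linarith
      then show ?thesis by (auto simp: early_weight_def c_def)
    qed
    ultimately show ?thesis using v by force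
  qed
qed

lemma reply_deg_4:
  assumes W: "W \<subseteq> V" and x: "x \<in> V" "card (N x \<inter> W) = 4" and mx: "max_deg W 4"
  shows "\<exists>v\<in>V. 56 \<le> gain late_weight W v"
proof -
  consider (white) w where "w \<in> W" "card (N w \<inter> W) = 4"
    | (blue) "x \<notin> W" "\<And>u. u \<in> W \<Longrightarrow> card (N u \<inter> W) \<le> 4 - 1"
    using white_or_blue_max[OF W x _ mx] by auto
  then show ?thesis
  proof cases
    case white
    \<comment> \<open>Here \<open>c = 2\<close> is affordable: 20 + 3 * 12 = 56.\<close>
    have "20 + int (4 - 1) * (20 - late_weight (4 - 2) + 2) \<le> gain late_weight W w"
      using white mx by (intro white_max_gain admissible_late W) (auto simp: late_weight_def)
    then show ?thesis using white W by (force simp: late_weight_def)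
  next
    case blue
    \<comment> \<open>A drop from degree 4 to 3 costs only 1, so \<open>c = 1\<close>: 13 + 4 * 11 =
      57.\<close>
    have "late_weight 4 + int 4 * (20 - late_weight (4 - 2) + 1) \<le> gain late_weight W x"
      using blue mx x by (intro blue_max_gain admissible_late W) (auto simp: late_weight_def)
    then show ?thesis using x by (force simp: late_weight_def)
  qed
qed

text \<open>This is the advantage of the late weights: up to degree 3 a vertex can pay 2 for each
  white neighbour that it loses, where early weights may drop by only 1.\<close>

lemma late_drop:
  assumes "t \<le> d" "d \<le> 3"
  shows "2 * int t \<le> late_weight d - late_weight (d - t)"
  using assms by (auto simp: late_weight_def)

text \<open>As degrees are at most 3, \<open>x\<close> sees exactly the white vertices that
  \<open>v\<close> sees and loses its full weight 12. With 20 for \<open>v\<close> and 12 for each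
  of its two white neighbours this makes 56.\<close>

lemma reply_white_deg_3_covered:
  assumes W: "W \<subseteq> V" and v: "v \<in> W" "card (N v \<inter> W) = 3" and mx: "max_deg W 3"
    and x: "x \<in> V - W" "N v \<inter> W \<subseteq> N x"
  shows "56 \<le> gain late_weight W v"
proof -
  have vV: "v \<in> V" using v W by blast
  have m: "mono late_weight" using admissible_late by (simp add: admissible_def)
  have "N v \<inter> W = N x \<inter> W"
    using x v max_degD[OF mx, of x] finN[of x] by (intro card_seteq) auto
  then have N0: "card (N x \<inter> W) = 3" "N x \<inter> (W - N v) = {}" using v by auto
  have "weight late_weight W v
     + (\<Sum>u\<in>N v \<inter> W - {v}. 20 - late_weight (card (N u \<inter> (W - N v))))
     + (\<Sum>x\<in>{x}. late_weight (card (N x \<inter> W)) - late_weight (card (N x \<inter> (W - N v))))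
     \<le> gain late_weight W v"
    using x v by (intro gain_ge admissible_late W vV) auto
  moreover have "(\<Sum>u\<in>N v \<inter> W - {v}. 12) \<le> (\<Sum>u\<in>N v \<inter> W - {v}. 20 - late_weight (card (N u \<inter> (W - N v))))"
  proof (rule sum_mono)
    fix u assume u: "u \<in> N v \<inter> W - {v}"
    then have uV: "u \<in> V" using W by auto
    have "card (N u \<inter> (W - N v)) \<le> 3 - card {u, v}"
      using u v self sym max_degD[OF mx uV] by (intro card_after_le uV) auto
    then have "card (N u \<inter> (W - N v)) \<le> 1" using u by auto
    then have "late_weight (card (N u \<inter> (W - N v))) \<le> late_weight 1" using m by (auto simp: mono_def)
    then show "12 \<le> 20 - late_weight (card (N u \<inter> (W - N v)))" by (simp add: late_weight_def)
  qed
  moreover have "card (N v \<inter> W - {v}) = 2" using v self by (simp add: card_Diff_singleton)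
  ultimately show ?thesis using v N0 by (simp add: weight_def late_weight_def)
qed

text \<open>For degree 3, \<open>white_max_gain\<close> yields only 52, with \<open>c = 4\<close>.
  When no nonwhite vertex covers the white neighbourhood of a white vertex of degree 3, the
  triangles have distinct third vertices, and these supply the rest.\<close>

lemma reply_white_deg_3:
  assumes W: "W \<subseteq> V" and v: "v \<in> W" "card (N v \<inter> W) = 3" and mx: "max_deg W 3"
  shows "\<exists>v\<in>V. 56 \<le> gain late_weight W v"
proof (cases "\<exists>w\<in>W. \<exists>x\<in>V - W. card (N w \<inter> W) = 3 \<and> N w \<inter> W \<subseteq> N x")
  case True
  then show ?thesis using reply_white_deg_3_covered[OF W _ _ mx] W by blast
next
  case False
  have vV: "v \<in> V" using v W by blast
  have "v \<in> N v \<inter> W" using v self by blast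
  with v(2) obtain a c where ac: "N v \<inter> W = {v, a, c}" "a \<noteq> v" "c \<noteq> v" "a \<noteq> c"
    by (rule obtain_three_distinct)
  then have acW: "a \<in> W" "c \<in> W" "a \<in> N v" "c \<in> N v" by auto
  then have acV: "a \<in> V" "c \<in> V" using W by auto
  have A: "N v \<inter> W - {v} = {a, c}" using ac by auto
  obtain r where r: "r \<in> N a" "r \<in> N v" "r \<noteq> a" "r \<noteq> v" using tri[OF vV acW(3) ac(2)] by blast
  obtain q where q: "q \<in> N c" "q \<in> N v" "q \<noteq> c" "q \<noteq> v" using tri[OF vV acW(4) ac(3)] by blast
  show ?thesis
  proof (cases "r \<in> W \<or> q \<in> W")
    case True
    \<comment> \<open>A white \<open>r\<close> lies in \<open>N v \<inter> W\<close>, hence equals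
      \<open>c\<close>; likewise a white \<open>q\<close> equals \<open>a\<close>. Then
      \<open>v\<close>, \<open>a\<close> and \<open>c\<close> are mutually adjacent and each loses
      20.\<close>
    then have adj: "c \<in> N a" "a \<in> N c" using r q ac sym by blast+
    have "card (N u \<inter> (W - N v)) = 0" if "u \<in> {a, c}" for u
    proof -
      have "card (N u \<inter> (W - N v)) \<le> 3 - card {v, a, c}"
        using that adj acW v self sym max_degD[OF mx] acV by (intro card_after_le) auto
      then show ?thesis using ac by simp
    qed
    then have "late_weight (card (N u \<inter> (W - N v))) \<le> 0" if "u \<in> N v \<inter> W - {v}" for u
      using that A by (simp add: late_weight_def)
    then have "weight late_weight W v + int (card (N v \<inter> W - {v})) * (20 - 0) \<le> gain late_weight W v"
      by (intro gain_ge_crude admissible_late W vV)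
    then show ?thesis using A ac v vV by (force simp: weight_def)
  next
    case outer: False
    \<comment> \<open>Every nonwhite vertex now pays 2 to each of \<open>v\<close>, \<open>a\<close>
      and \<open>c\<close> that it is adjacent to. The vertex \<open>v\<close> receives at least 4
      on top of its 20, while \<open>a\<close> and \<open>c\<close> account for at least 16 each: 24
      + 32 = 56.\<close>
    let ?X = "V - W"
    have f: "finite ?X" "finite (N v \<inter> W)" using fin finN[OF vV] by auto
    have rV: "r \<in> ?X" "q \<in> ?X" using r q outer sub[OF vV] by auto
    have "r \<noteq> q"
    proof
      assume "r = q"
      then have "N v \<inter> W \<subseteq> N r"
        unfolding ac(1) using sym[OF r(1)] sym[OF r(2)] sym[OF q(1)] by simp
      then show False using False v rV by blast
    qed
    then have ev: "2 \<le> card (N v \<inter> ?X)"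
      using card_mono[of "N v \<inter> ?X" "{r, q}"] r q rV finN[OF vV] by auto
    have eu: "16 \<le> 20 - late_weight (card (N u \<inter> (W - N v))) + 2 * int (card (N u \<inter> ?X))"
      if u: "u \<in> N v \<inter> W - {v}" for u
    proof -
      have uV: "u \<in> V" "u \<in> W" "u \<in> N v" "u \<noteq> v" using u W by auto
      obtain p where p: "p \<in> N u" "p \<in> N v" "p \<in> ?X"
        using u A r q rV by auto
      have c1: "card (N u \<inter> (W - N v)) \<le> 3 - card {u, v}"
        using u v self sym max_degD[OF mx uV(1)] by (intro card_after_le uV) auto
      show ?thesis
      proof (cases "N u \<inter> (W - N v) = {}")
        case True
        then show ?thesis by (simp add: late_weight_def)
      next
        \<comment> \<open>One white neighbour \<open>w\<close> remains, so \<open>u\<close> itself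
          loses 12. The other 4 come from two nonwhite neighbours: \<open>p\<close> on a triangle
          with \<open>u\<close> and \<open>v\<close>, and \<open>g\<close> on a triangle with
          \<open>u\<close> and \<open>w\<close>. If they coincided, that vertex would cover
          \<open>N u \<inter> W\<close>.\<close>
        case False': False
        then have c1': "card (N u \<inter> (W - N v)) = 1"
          using c1 uV finN[OF uV(1)] by (simp add: le_Suc_eq card_eq_0_iff)
        obtain w where w: "w \<in> N u" "w \<in> W" "w \<notin> N v" using False' by blast
        then have "w \<noteq> u" using uV by blast
        have "{u, v, w} \<subseteq> N u \<inter> W" using w uV v self sym by auto
        moreover have "w \<noteq> v" using w self by blast
        then have "card {u, v, w} = 3" using uV(4) \<open>w \<noteq> u\<close> by simp
        ultimately have Nu: "N u \<inter> W = {u, v, w}"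
          using max_degD[OF mx uV(1)] finN[OF uV(1)] by (metis card_seteq finite_Int)
        obtain g where g: "g \<in> N w" "g \<in> N u" "g \<noteq> w" "g \<noteq> u"
          using tri[OF uV(1) w(1) \<open>w \<noteq> u\<close>] by blast
        have "g \<noteq> v" using g w sym by blast
        then have gX: "g \<in> ?X" using Nu g sub[OF uV(1)] by blast
        have "g \<noteq> p"
        proof
          assume "g = p"
          then have "N u \<inter> W \<subseteq> N p" 
            unfolding Nu using sym[OF p(1)] sym[OF p(2)] sym[OF g(1)] by simp
          then show False using False uV p Nu \<open>card {u, v, w} = 3\<close> by auto
        qed
        then have "2 \<le> card (N u \<inter> ?X)"
          using card_mono[of "N u \<inter> ?X" "{p, g}"] p g gX finN[OF uV(1)] by auto
        then show ?thesis using c1' by (simp add: late_weight_def)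
      qed
    qed
    have "2 * int (card (N v \<inter> ?X)) + (\<Sum>u\<in>N v \<inter> W - {v}. 2 * int (card (N u \<inter> ?X)))
        = 2 * int (\<Sum>u\<in>N v \<inter> W. card (N u \<inter> ?X))"
      using f(2) v(1) self by (simp add: sum.remove[of _ v] sum_distrib_left)
    also have "(\<Sum>u\<in>N v \<inter> W. card (N u \<inter> ?X)) = (\<Sum>x\<in>?X. card (N x \<inter> (N v \<inter> W)))"
      using double_count f by metis
    also have "2 * int (\<Sum>x\<in>?X. card (N x \<inter> (N v \<inter> W)))
        = (\<Sum>x\<in>?X. 2 * int (card (N x \<inter> (N v \<inter> W))))"
      by (simp add: sum_distrib_left)
    also have "\<dots> \<le> (\<Sum>x\<in>?X. late_weight (card (N x \<inter> W)) - late_weight (card (N x \<inter> (W - N v))))"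
      using late_drop card_after max_degD[OF mx] by (intro sum_mono) auto
    finally have "2 * int (card (N v \<inter> ?X)) + (\<Sum>u\<in>N v \<inter> W - {v}. 2 * int (card (N u \<inter> ?X)))
      \<le> (\<Sum>x\<in>?X. late_weight (card (N x \<inter> W)) - late_weight (card (N x \<inter> (W - N v))))" .
    moreover have "int (card (N v \<inter> W - {v})) * 16 \<le> (\<Sum>u\<in>N v \<inter> W - {v}.
        20 - late_weight (card (N u \<inter> (W - N v))) + 2 * int (card (N u \<inter> ?X)))"
      using sum_mono[of "N v \<inter> W - {v}" "\<lambda>_. 16", OF eu] by simp
    moreover have "card (N v \<inter> W - {v}) = 2" using A ac by simp
    moreover have "weight late_weight W v = 20" using v by (simp add: weight_def)
    ultimately have "56 \<le> gain late_weight W v"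
      using gain_ge[OF admissible_late W vV, of ?X] v ev by (simp add: sum.distrib)
    then show ?thesis using vV by blast
  qed
qed

text \<open>The bound 12 + 3 * 14 = 54 is two short of 56; \<open>round_deg_3\<close> makes up for
  this.\<close>

lemma reply_blue_deg_3:
  assumes W: "W \<subseteq> V" and v: "v \<in> V" "v \<notin> W" "card (N v \<inter> W) = 3" and mx: "max_deg W 3"
    and white: "\<And>u. u \<in> W \<Longrightarrow> card (N u \<inter> W) \<le> 2"
  shows "54 \<le> gain late_weight W v"
proof -
  have "late_weight 3 + int 3 * (20 - late_weight (3 - 2) + 2) \<le> gain late_weight W v"
    using v mx white late_drop by (intro blue_max_gain admissible_late W) (auto simp: late_weight_def)
  then show ?thesis by (simp add: late_weight_def)
qed

section \<open>Staller's moves\<close>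

text \<open>A white \<open>v\<close> is worth 20 by itself, and a nonwhite \<open>v\<close> with two
  white neighbours at least 8 + 2 * 6. Less is possible only if \<open>v\<close> is nonwhite and
  dominates a single new vertex \<open>u\<close>.\<close>

lemma staller_gain:
  assumes b: "admissible b" "8 \<le> b 1" and W: "W \<subseteq> V" and v: "v \<in> V" "N v \<inter> W \<noteq> {}"
  obtains "20 \<le> gain b W v"
  | u where "v \<notin> W" "N v \<inter> W = {u}"
      "\<And>X. X \<subseteq> V - W - {v} \<Longrightarrow> b 1 + (20 - b (card (N u \<inter> (W - N v))))
        + (\<Sum>x\<in>X. b (card (N x \<inter> W)) - b (card (N x \<inter> (W - N v)))) \<le> gain b W v"
proof (cases "v \<in> W")
  case True
  have "weight b W v + int (card (N v \<inter> W - {v})) * (20 - 14) \<le> gain b W v"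
    using b by (intro gain_ge_crude W v) (auto simp: admissible_def)
  then show ?thesis using that(1) True by (simp add: weight_def)
next
  case False
  show ?thesis
  proof (cases "card (N v \<inter> W) = 1")
    case True
    then obtain u where u: "N v \<inter> W = {u}" by (auto simp: card_1_singleton_iff)
    have "b 1 + (20 - b (card (N u \<inter> (W - N v))))
        + (\<Sum>x\<in>X. b (card (N x \<inter> W)) - b (card (N x \<inter> (W - N v)))) \<le> gain b W v"
      if "X \<subseteq> V - W - {v}" for X
    proof -
      have "N v \<inter> W - {v} = {u}" using u False by auto
      then show ?thesis using gain_ge[OF b(1) W v(1) that] u False by (simp add: weight_def)
    qed
    then show ?thesis using that(2) False u by blast
  next
    case ne: False
    then have c: "2 \<le> card (N v \<inter> W)"
      using v finN[OF v(1)] by (metis One_nat_def Suc_leI card_gt_0_iff finite_Int le_neq_implies_less numeral_2_eq_2)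
    have "weight b W v + int (card (N v \<inter> W - {v})) * (20 - 14) \<le> gain b W v"
      using b by (intro gain_ge_crude W v) (auto simp: admissible_def)
    moreover have "b 1 \<le> weight b W v" using False b c by (auto simp: weight_def admissible_def mono_def)
    moreover have "N v \<inter> W - {v} = N v \<inter> W" using False by blast
    ultimately show ?thesis using that(1) c b by force
  qed
qed

lemma after_staller:
  assumes v: "N v \<inter> W = {u}" and x: "x \<in> V" "x \<in> N u"
  shows "card (N x \<inter> W) = Suc (card (N x \<inter> (W - N v)))"
proof -
  have "N x \<inter> (N v \<inter> W) = {u}" using v x sym by auto
  moreover have "card (N x \<inter> W) > 0"
    using calculation finN[OF x(1)] by (auto simp: card_gt_0_iff)
  ultimately show ?thesis using card_after(1)[OF x(1), of W v] by simp
qed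

lemma staller_gain_early:
  assumes W: "W \<subseteq> V" and v: "v \<in> V" "N v \<inter> W \<noteq> {}"
  shows "16 \<le> gain early_weight W v"
proof -
  have "8 \<le> early_weight 1" by (simp add: early_weight_def)
  from admissible_early this W v show ?thesis
  proof (cases rule: staller_gain)
    case (2 u)
    have "early_weight (card (N u \<inter> (W - N v))) \<le> 14" using admissible_early by (simp add: admissible_def)
    moreover have "early_weight 1 = 10" by (simp add: early_weight_def)
    ultimately show ?thesis using 2(3)[of "{}"] by simp
  qed simp
qed

text \<open>In the small case the third vertex \<open>z\<close> of a triangle on \<open>u\<close>
  and \<open>v\<close> is nonwhite, since \<open>u\<close> is the only white vertex of
  \<open>N v\<close>, and every neighbour of \<open>u\<close> loses exactly one from its degree. The
  constant 28 is 8 for \<open>v\<close> plus 20 for \<open>u\<close>.\<close>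

lemma staller_gain_late:
  assumes W: "W \<subseteq> V" and v: "v \<in> V" "N v \<inter> W \<noteq> {}"
  obtains (big) "20 \<le> gain late_weight W v"
  | (small) u z where "v \<notin> W" "N v \<inter> W = {u}" "z \<in> V - W - {v}" "z \<in> N u"
      "\<And>X. X \<subseteq> V - W - {v} \<Longrightarrow> X \<subseteq> N u \<Longrightarrow> finite X \<Longrightarrow>
        28 - late_weight (card (N u \<inter> (W - N v)))
        + (\<Sum>x\<in>X. late_weight (Suc (card (N x \<inter> (W - N v)))) - late_weight (card (N x \<inter> (W - N v))))
        \<le> gain late_weight W v"
proof -
  have "8 \<le> late_weight 1" by (simp add: late_weight_def)
  from admissible_late this W v show ?thesis
  proof (cases rule: staller_gain)
    case (2 u)
    then have u: "u \<in> N v" "u \<noteq> v" by auto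
    obtain z where z: "z \<in> N u" "z \<in> N v" "z \<noteq> u" "z \<noteq> v" using tri[OF v(1) u] by blast
    have "z \<in> V - W - {v}" using z 2 sub[OF v(1)] by blast
    moreover have "28 - late_weight (card (N u \<inter> (W - N v)))
        + (\<Sum>x\<in>X. late_weight (Suc (card (N x \<inter> (W - N v)))) - late_weight (card (N x \<inter> (W - N v))))
        \<le> gain late_weight W v" if X: "X \<subseteq> V - W - {v}" "X \<subseteq> N u" for X
    proof -
      have "(\<Sum>x\<in>X. late_weight (Suc (card (N x \<inter> (W - N v)))) - late_weight (card (N x \<inter> (W - N v))))
        = (\<Sum>x\<in>X. late_weight (card (N x \<inter> W)) - late_weight (card (N x \<inter> (W - N v))))"
        using X after_staller[OF 2(2)] by (intro sum.cong refl) (metis DiffD1 subsetD)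
      moreover have "late_weight 1 = 8" by (simp add: late_weight_def)
      ultimately show ?thesis using 2(3)[OF X(1)] by simp
    qed
    ultimately show ?thesis using small[of u z] 2 z by blast
  qed (use big in simp)
qed

lemma late_step:
  "d \<le> 4 \<Longrightarrow> 1 \<le> late_weight (Suc d) - late_weight d"
  "d \<le> 2 \<Longrightarrow> 2 \<le> late_weight (Suc d) - late_weight d"
  by (auto simp: late_weight_def)

text \<open>The degree bounds after the move limit the new weight of \<open>u\<close> and force a
  loss at \<open>z\<close>: 28 - 13 + 1 = 16 and 28 - 10 + 2 = 20.\<close>

lemma staller_gain_late_bounds:
  assumes W: "W \<subseteq> V" and v: "v \<in> V" "N v \<inter> W \<noteq> {}"
  shows "max_deg (W - N v) 4 \<Longrightarrow> 16 \<le> gain late_weight W v"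
    and "max_deg (W - N v) 2 \<Longrightarrow> 20 \<le> gain late_weight W v"
proof -
  consider (big) "20 \<le> gain late_weight W v"
    | (small) u z where "u \<in> V" "z \<in> V" "28 - late_weight (card (N u \<inter> (W - N v)))
        + (late_weight (Suc (card (N z \<inter> (W - N v)))) - late_weight (card (N z \<inter> (W - N v))))
        \<le> gain late_weight W v"
    using W v
  proof (cases rule: staller_gain_late)
    case (small u z)
    show ?thesis using small(5)[of "{z}"] small(1-4) W that(2)[of u z] by auto
  qed (use that in blast)
  note c = this
  show "16 \<le> gain late_weight W v" if m: "max_deg (W - N v) 4"
    using c
  proof cases
    case (small u z)
    have "late_weight (card (N u \<inter> (W - N v))) \<le> 13"
      using max_degD[OF m small(1)] by (auto simp: late_weight_def)
    then show ?thesis using late_step(1)[OF max_degD[OF m small(2)]] small(3) by linarith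
  qed simp
  show "20 \<le> gain late_weight W v" if m: "max_deg (W - N v) 2"
    using c
  proof cases
    case (small u z)
    have "late_weight (card (N u \<inter> (W - N v))) \<le> 10"
      using max_degD[OF m small(1)] by (auto simp: late_weight_def)
    then show ?thesis using late_step(2)[OF max_degD[OF m small(2)]] small(3) by linarith
  qed simp
qed

section \<open>Rounds with maximum degree 3 after Staller's move\<close>

text \<open>White degrees are at most 2, so two adjacent white neighbours of \<open>v\<close> lose
  20 each, giving 12 + 20 + 20 + 12 = 64. If no two are adjacent, \<open>cov\<close> makes
  \<open>z\<close> see all three, and its full loss gives 12 + 3 * 12 + 12 = 60.\<close>

lemma blue_deg_3_covered:
  assumes W: "W \<subseteq> V" and v: "v \<in> V" "v \<notin> W" "card (N v \<inter> W) = 3" and mx: "max_deg W 3"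
    and white: "\<And>u. u \<in> W \<Longrightarrow> card (N u \<inter> W) \<le> 2"
    and z: "z \<in> V - W - {v}"
    and cov: "\<And>u. u \<in> N v \<inter> W \<Longrightarrow> u \<in> N z \<or> (\<exists>w\<in>N v \<inter> W. w \<noteq> u \<and> w \<in> N u)"
  shows "56 \<le> gain late_weight W v"
proof -
  let ?A = "N v \<inter> W" and ?h = "\<lambda>u. 20 - late_weight (card (N u \<inter> (W - N v)))"
  have fA: "finite ?A" "?A - {v} = ?A" using finN v by auto
  have h: "card (N u \<inter> (W - N v)) \<le> 2 - card Y" if "u \<in> ?A" "Y \<subseteq> N u \<inter> N v \<inter> W" for u Y
    using that W white by (intro card_after_le) auto
  have h12: "12 \<le> ?h u" if "u \<in> ?A" for u
    using h[OF that, of "{u}"] that self by (auto simp: late_weight_def)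
  have h20: "?h u = 20" if "u \<in> ?A" "w \<in> ?A" "w \<noteq> u" "w \<in> N u" for u w
    using h[OF that(1), of "{u, w}"] that self by (auto simp: late_weight_def)
  have g: "12 + (\<Sum>u\<in>?A. ?h u) + (\<Sum>x\<in>X. late_weight (card (N x \<inter> W)) - late_weight (card (N x \<inter> (W - N v))))
      \<le> gain late_weight W v" if "X \<subseteq> V - W - {v}" for X
    using gain_ge[OF admissible_late W v(1) that] v fA by (simp add: weight_def late_weight_def)
  show ?thesis
  proof (cases "\<exists>u\<in>?A. \<exists>w\<in>?A. w \<noteq> u \<and> w \<in> N u")
    case True
    then obtain u w where uw: "u \<in> ?A" "w \<in> ?A" "w \<noteq> u" "w \<in> N u" by blast
    have "(\<Sum>x\<in>?A. if x \<in> {u, w} then 20 else 12) \<le> (\<Sum>u\<in>?A. ?h u)"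
      using h12 h20 uw sym by (intro sum_mono) auto
    moreover have "(\<Sum>x\<in>?A. if x \<in> {u, w} then 20 else 12 :: int) = 52"
    proof -
      have "?A \<inter> {x. x \<in> {u, w}} = {u, w}" "?A \<inter> - {x. x \<in> {u, w}} = ?A - {u, w}"
        using uw by auto
      moreover have "card (?A - {u, w}) = 1"
        using uw v card_Diff_subset[of "{u, w}" ?A] by simp
      ultimately show ?thesis using fA(1) uw(3) by (simp only: sum.If_cases) simp
    qed
    ultimately show ?thesis using g[of "{}"] by simp
  next
    case False
    then have "?A \<subseteq> N z" using cov by blast
    then have "?A = N z \<inter> W"
      using z v max_degD[OF mx, of z] finN[of z] by (intro card_seteq) auto
    then have "card (N z \<inter> W) = 3" "N z \<inter> (W - N v) = {}" using v by auto
    moreover have "int (card ?A) * 12 \<le> (\<Sum>u\<in>?A. ?h u)"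
      using sum_mono[of ?A "\<lambda>_. 12", OF h12] by simp
    ultimately show ?thesis using g[of "{z}"] z v by (simp add: late_weight_def)
  qed
qed

text \<open>A reply worth 54 suffices once Staller has gained 18. If Staller gained less, only one
  vertex \<open>u\<close> was newly dominated; it now has degree 3 and only one previously nonwhite
  neighbour besides \<open>v\<close>, so replying at \<open>u\<close> gains 56. The separate bound
  54 serves the first round.\<close>

lemma round_deg_3:
  assumes W: "W \<subseteq> V" and v: "v \<in> V" "N v \<inter> W \<noteq> {}"
    and mx: "max_deg (W - N v) 3" and x: "x \<in> V" "card (N x \<inter> (W - N v)) = 3"
  shows "\<exists>w\<in>V. 54 \<le> gain late_weight (W - N v) w
    \<and> 72 \<le> gain late_weight W v + gain late_weight (W - N v) w"
proof -
  let ?W = "W - N v"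
  have W1: "?W \<subseteq> V" using W by blast
  have "max_deg ?W 4" using mx by (force simp: max_deg_def)
  then have s16: "16 \<le> gain late_weight W v" using staller_gain_late_bounds(1)[OF W v] by blast
  show ?thesis
  proof (cases "\<exists>w\<in>?W. card (N w \<inter> ?W) = 3")
    case True
    then obtain w where "w \<in> V" "56 \<le> gain late_weight ?W w"
      using reply_white_deg_3[OF W1 _ _ mx] by blast
    then show ?thesis using s16 by force
  next
    case False
    have white: "card (N u \<inter> ?W) \<le> 2" if "u \<in> ?W" for u
      using False that max_degD[OF mx, of u] W by (force simp: le_Suc_eq numeral_eq_Suc)
    have blue: "54 \<le> gain late_weight ?W w" if "w \<in> V" "w \<notin> ?W" "card (N w \<inter> ?W) = 3" for w
      using reply_blue_deg_3[OF W1 that mx white] .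
    show ?thesis
    proof (cases "18 \<le> gain late_weight W v")
      case True
      then show ?thesis using blue[of x] x False by force
    next
      case s: False
      show ?thesis
        using W v
      proof (cases rule: staller_gain_late)
        case (small u z)
        have u: "u \<in> V" "u \<in> W" "u \<in> N v" "u \<notin> ?W" using small W by auto
        \<comment> \<open>A degree of at most 2 would leave \<open>u\<close> a weight of at most 10,
          and 28 - 10 = 18.\<close>
        have "card (N u \<inter> ?W) = 3"
        proof (rule ccontr)
          assume "card (N u \<inter> ?W) \<noteq> 3"
          then have "card (N u \<inter> ?W) \<le> 2" using max_degD[OF mx u(1)] by linarith
          then have "late_weight (card (N u \<inter> ?W)) \<le> 10" by (auto simp: late_weight_def)
          then show False using small(5)[of "{}"] s by simp
        qed
        note u3 = u(1,4) this
        have "56 \<le> gain late_weight ?W u"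
        proof (rule blue_deg_3_covered[OF W1 u3 mx white])
          show "z \<in> V - ?W - {u}" using small u by auto
        next
          fix a assume a: "a \<in> N u \<inter> ?W"
          then have "a \<in> N u" "a \<noteq> u" using u by auto
          then obtain r where r: "r \<in> N a" "r \<in> N u" "r \<noteq> a" "r \<noteq> u" using tri[OF u(1)] by blast
          show "a \<in> N z \<or> (\<exists>w\<in>N u \<inter> ?W. w \<noteq> a \<and> w \<in> N a)"
          proof (cases "r \<in> W")
            case True
            then have "r \<in> ?W" using r small by blast
            then show ?thesis using r by blast
          next
            case rW: False
            have "a \<notin> N v" using a by blast
            then have "r \<noteq> v" using r sym by blast
            then have rV: "r \<in> V - W - {v}" using rW r sub[OF u(1)] by blast
            \<comment> \<open>A nonwhite neighbour \<open>r\<close> of \<open>u\<close> besides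
              \<open>v\<close> and \<open>z\<close> would raise Staller's gain to 28 - 12 + 1 + 1 =
              18.\<close>
            have "r = z"
            proof (rule ccontr)
              assume "r \<noteq> z"
              have "late_weight (card (N u \<inter> ?W)) = 12" using u3 by (simp add: late_weight_def)
              moreover have "1 \<le> late_weight (Suc (card (N x \<inter> ?W))) - late_weight (card (N x \<inter> ?W))"
                if "x \<in> V" for x using max_degD[OF mx that] by (intro late_step(1)) simp
              then have "1 \<le> late_weight (Suc (card (N z \<inter> ?W))) - late_weight (card (N z \<inter> ?W))"
                 "1 \<le> late_weight (Suc (card (N r \<inter> ?W))) - late_weight (card (N r \<inter> ?W))"
                using rV small(3) by blast+
              ultimately show False
                using small(5)[of "{z, r}"] \<open>r \<noteq> z\<close> rV small(3,4) r(2) s by simp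
            qed
            then show ?thesis using r sym by blast
          qed
        qed
        then show ?thesis using u s16 by force
      qed (use s in simp)
    qed
  qed
qed

section \<open>Maximum degree 2 and decided positions\<close>

text \<open>Each move now removes exactly one of the classes \<open>N p \<inter> W\<close>, so the length of the
  remaining game does not depend on the play.\<close>
definition decided :: "'a set \<Rightarrow> bool" where
  "decided W \<longleftrightarrow> (\<forall>p\<in>W. \<forall>x\<in>N p. N x \<inter> W = N p \<inter> W)"

text \<open>With degrees at most 2, \<open>p\<close>, \<open>q\<close> and the third vertex
  \<open>s\<close> of a triangle on them see exactly \<open>p\<close> and \<open>q\<close>. Playing
  \<open>p\<close> therefore costs them 20, 20 and 10; the vertex \<open>x\<close> differs from
  \<open>s\<close> and loses at least 2.\<close>

lemma reply_pair:
  assumes W: "W \<subseteq> V" and mx: "max_deg W 2"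
    and pq: "p \<in> W" "q \<in> W" "p \<noteq> q" "q \<in> N p" and x: "x \<in> V" "p \<in> N x" "q \<notin> N x"
  shows "52 \<le> gain late_weight W p"
proof -
  have pqV: "p \<in> V" "q \<in> V" using pq W by auto
  have pair: "N y \<inter> W = {p, q}" if "y \<in> V" "p \<in> N y" "q \<in> N y" for y
    using card_seteq[of "N y \<inter> W" "{p, q}"] that pq max_degD[OF mx, of y] finN[of y] by auto
  have P: "N p \<inter> W = {p, q}" and Q: "N q \<inter> W = {p, q}"
    using pair pqV pq self sym by auto
  obtain s where s: "s \<in> N q" "s \<in> N p" "s \<noteq> q" "s \<noteq> p" using tri[OF pqV(1) pq(4)] pq by blast
  have sV: "s \<in> V" "s \<notin> W" using s P sub[OF pqV(1)] by auto
  have S: "N s \<inter> W = {p, q}" using pair sV s sym by blast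
  have "x \<noteq> p" "x \<noteq> q" using x pq self by auto
  then have xW: "x \<notin> W" using P x sym by blast
  have "x \<noteq> s" using s x sym by blast
  have "N q \<inter> (W - N p) = {}" "N s \<inter> (W - N p) = {}" using Q S self[of p] pq(4) by auto
  moreover have "N p \<inter> W - {p} = {q}" using P pq(3) by auto
  moreover have "card (N s \<inter> W) = 2" using S pq(3) by simp
  moreover have "late_weight 0 = 0" "late_weight 2 = 10" by (auto simp: late_weight_def)
  moreover have "{s, x} \<subseteq> V - W - {p}" using x(1) xW sV pq(1) by auto
  ultimately have "weight late_weight W p + 20 + (10 + (late_weight (card (N x \<inter> W))
      - late_weight (card (N x \<inter> (W - N p))))) \<le> gain late_weight W p"
    using gain_ge[OF admissible_late W pqV(1), of "{s, x}"] \<open>x \<noteq> s\<close> by simp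
  moreover have "p \<in> N x \<inter> (N p \<inter> W)" using x pq self by blast
  then have "1 \<le> card (N x \<inter> (N p \<inter> W))"
    using finN[OF x(1)] by (simp add: Suc_le_eq card_gt_0_iff) blast
  then have "2 \<le> late_weight (card (N x \<inter> W)) - late_weight (card (N x \<inter> (W - N p)))"
    using late_drop[OF card_after(2)[OF x(1)], of W p] card_after(1)[OF x(1), of W p] max_degD[OF mx x(1)]
    by simp
  ultimately show ?thesis using pq by (simp add: weight_def)
qed

text \<open>Both \<open>p\<close> and \<open>q\<close> lose their whole weight, and each lies in a
  triangle with \<open>x\<close> whose third vertex is nonwhite and pays 2. In total 10 + 2 * 22 =
  54.\<close>

lemma reply_two_singles:
  assumes W: "W \<subseteq> V" and mx: "max_deg W 2"
    and x: "x \<in> V" "x \<notin> W" "N x \<inter> W = {p, q}" "p \<noteq> q"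
    and pq: "N p \<inter> W = {p}" "N q \<inter> W = {q}"
  shows "52 \<le> gain late_weight W x"
proof -
  have A: "N x \<inter> W - {x} = {p, q}" using x by auto
  have "weight late_weight W x + int (card (N x \<inter> W - {x})) * 22 \<le> gain late_weight W x"
  proof (rule gain_ge_uniform[OF admissible_late W x(1), where X = "V - W - {x}" and c = 2])
    fix y assume y: "y \<in> V - W - {x}"
    have "N x \<inter> W - {x} = N x \<inter> W" using x by blast
    then show "2 * int (card (N y \<inter> (N x \<inter> W - {x})))
        \<le> late_weight (card (N y \<inter> W)) - late_weight (card (N y \<inter> (W - N x)))"
      using y late_drop[OF card_after(2), of y W x] card_after(1)[of y W x] max_degD[OF mx, of y] by simp
  next
    fix u assume "u \<in> N x \<inter> W - {x}"
    then have u: "u \<in> N x" "u \<noteq> x" "u \<in> V" "N u \<inter> W = {u}" using W pq A by auto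
    obtain r where r: "r \<in> N u" "r \<in> N x" "r \<noteq> u" "r \<noteq> x" using tri[OF x(1) u(1,2)] by blast
    then have "r \<in> N u \<inter> (V - W - {x})" using u sub by blast
    then have "1 \<le> card (N u \<inter> (V - W - {x}))"
      using finN[OF u(3)] by (simp add: Suc_le_eq card_gt_0_iff) blast
    moreover have "N u \<inter> (W - N x) = {}" using u(1,4) by auto
    ultimately show "22 \<le> 20 - late_weight (card (N u \<inter> (W - N x))) + 2 * int (card (N u \<inter> (V - W - {x})))"
      by (simp add: late_weight_def)
  qed simp
  then show ?thesis using A x by (simp add: weight_def late_weight_def)
qed

text \<open>An undecided position has a white \<open>p\<close> and a nonwhite
  \<open>x \<in> N p\<close> that see different white vertices. Either some white vertex of
  \<open>N x\<close> has a white neighbour outside \<open>N x\<close>, as in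
  \<open>reply_pair\<close>, or \<open>N x\<close> contains two white vertices without white
  neighbours, as in \<open>reply_two_singles\<close>.\<close>

lemma reply_deg_2:
  assumes W: "W \<subseteq> V" and mx: "max_deg W 2" and nd: "\<not> decided W"
  shows "\<exists>v\<in>V. 52 \<le> gain late_weight W v"
proof -
  obtain p x where p: "p \<in> W" "x \<in> N p" "N x \<inter> W \<noteq> N p \<inter> W"
    using nd by (auto simp: decided_def)
  then have V: "p \<in> V" "x \<in> V" using W sub by blast+
  have px: "p \<in> N x" using p sym by blast
  have pair: "N y \<inter> W = {a, c}" if "y \<in> V" "a \<in> N y" "c \<in> N y" "a \<in> W" "c \<in> W" "a \<noteq> c" for y a c
    using card_seteq[of "N y \<inter> W" "{a, c}"] that max_degD[OF mx, of y] finN[of y] by auto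
  have xW: "x \<notin> W"
  proof
    assume "x \<in> W"
    moreover have "x \<noteq> p" using p by blast
    ultimately show False using pair[of x p x] pair[of p p x] p V px self by auto
  qed
  show ?thesis
  proof (cases "N p \<inter> W = {p}")
    case True
    then have "N x \<inter> W \<noteq> {p}" "p \<in> N x \<inter> W" using p px by auto
    then obtain q where q: "q \<in> N x" "q \<in> W" "q \<noteq> p" by blast
    have X: "N x \<inter> W = {p, q}" using pair[OF V(2) px q(1) p(1) q(2)] q(3) by blast
    show ?thesis
    proof (cases "N q \<inter> W = {q}")
      case qq: True
      show ?thesis using reply_two_singles[OF W mx V(2) xW X q(3)[symmetric] True qq] V by blast
    next
      case False
      moreover have "q \<in> N q \<inter> W" using self q by blast
      ultimately obtain r where r: "r \<in> N q" "r \<in> W" "r \<noteq> q" by blast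
      have "r \<noteq> p" using True q sym[OF r(1)] by auto
      then have "r \<notin> N x" using X r by auto
      then have "52 \<le> gain late_weight W q"
        by (rule reply_pair[OF W mx q(2) r(2) r(3)[symmetric] r(1) V(2) q(1)])
      then show ?thesis using q W by blast
    qed
  next
    case False
    moreover have "p \<in> N p \<inter> W" using self p by blast
    ultimately obtain q where q: "q \<in> N p" "q \<in> W" "q \<noteq> p" by blast
    have "q \<notin> N x"
    proof
      assume "q \<in> N x"
      then show False
        using p(3) pair[OF V(2) px _ p(1) q(2)] pair[OF V(1) self q(1) p(1) q(2)] q(3) by simp
    qed
    then have "52 \<le> gain late_weight W p"
      by (rule reply_pair[OF W mx p(1) q(2) q(3)[symmetric] q(1) V(2) px])
    then show ?thesis using V by blast
  qed
qed

lemma decided_Diff: "decided W \<Longrightarrow> decided (W - N v)"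
  unfolding decided_def by (metis Diff_iff Int_Diff)

text \<open>For a white \<open>p\<close> in \<open>N v\<close>, all vertices of \<open>N p\<close>
  see the same white vertices as \<open>v\<close> and lose their whole weight: 20 for
  \<open>p\<close> and at least 8 for each of at least two neighbours.\<close>

lemma decided_gain:
  assumes W: "W \<subseteq> V" and v: "v \<in> V" "N v \<inter> W \<noteq> {}" and d: "decided W"
  shows "36 \<le> gain late_weight W v"
proof -
  obtain p where p: "p \<in> N v" "p \<in> W" using v by blast
  then have pV: "p \<in> V" using W by blast
  have eq: "N x \<inter> W = N v \<inter> W" if "x \<in> N p" for x
    using d p that sym by (metis decided_def)
  let ?D = "\<lambda>x. weight late_weight W x - weight late_weight (W - N v) x"
  have D: "8 \<le> ?D x" if x: "x \<in> N p" for x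
  proof -
    have "N x \<inter> (W - N v) = {}" "x \<notin> W - N v"
      using eq[OF x] eq[of p] self[of p] x by blast+
    moreover have "0 < card (N x \<inter> W)" using eq[OF x] v finN[OF v(1)] by (simp add: card_gt_0_iff)
    ultimately show ?thesis by (auto simp: weight_def late_weight_def)
  qed
  have Dp: "?D p = 20"
  proof -
    have "N p \<inter> (W - N v) = {}" using eq[OF self] by blast
    then show ?thesis using p by (simp add: weight_def late_weight_def)
  qed
  have "int (card (N p - {p})) * 8 \<le> sum ?D (N p - {p})"
    using sum_mono[of "N p - {p}" "\<lambda>_. 8" ?D] D by simp
  then have "36 \<le> sum ?D (N p)"
    using Dp card_N_ge_3[OF pV] self finN[OF pV] by (simp add: sum.remove[of _ p] card_Diff_singleton)
  then show ?thesis using gain_ge_sum[OF admissible_late W sub[OF pV], of v] by linarith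
qed

section \<open>Drop of the potential per round\<close>

text \<open>Degrees never grow, so the weights are switched at most once, and the switch can only
  lower the potential.\<close>

definition bound :: "'a set \<Rightarrow> int" where
  "bound W = (if \<exists>x\<in>V. 5 \<le> card (N x \<inter> W) then pot early_weight W else pot late_weight W)"

lemma pot_late_le_early: "pot late_weight W \<le> pot early_weight W"
  unfolding pot_def using late_le_early by (intro sum_mono) (simp add: weight_def)

lemma pot_late_nonneg: "0 \<le> pot late_weight W"
  unfolding pot_def by (intro sum_nonneg) (simp add: weight_def late_weight_def)

lemma bound_bounds: "pot late_weight W \<le> bound W" "bound W \<le> pot early_weight W"
  using pot_late_le_early by (auto simp: bound_def)

lemma max_deg_Diff:
  assumes "max_deg W k"
  shows "max_deg (W - N v) k"
  unfolding max_deg_def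
proof
  fix x assume x: "x \<in> V"
  have "card (N x \<inter> (W - N v)) \<le> card (N x \<inter> W)"
    using finN[OF x] by (intro card_mono) auto
  then show "card (N x \<inter> (W - N v)) \<le> k" using max_degD[OF assms x] by linarith
qed

lemma bound_late: "max_deg W 4 \<Longrightarrow> bound W = pot late_weight W"
  by (force simp: bound_def max_deg_def)

lemma bound_early:
  assumes "x \<in> V" "5 \<le> card (N x \<inter> (W - N v))"
  shows "bound W = pot early_weight W"
proof -
  have "card (N x \<inter> (W - N v)) \<le> card (N x \<inter> W)"
    using finN[OF assms(1)] by (intro card_mono) auto
  then show ?thesis using assms by (force simp: bound_def)
qed

text \<open>The position between the two moves decides which weights measure the round. A degree of
  at least 5 there was present before, so \<open>bound W\<close> is the early potential; otherwise
  the late potential is at most \<open>bound W\<close> and equals the bound at the end.\<close>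

lemma round_bound:
  assumes "x \<in> V \<and> 5 \<le> card (N x \<inter> (W - N v)) \<and>
        g \<le> gain early_weight W v + gain early_weight (W - N v) w
      \<or> max_deg (W - N v) 4 \<and> g \<le> gain late_weight W v + gain late_weight (W - N v) w"
  shows "bound (W - N v - N w) \<le> bound W - g"
  using assms
proof
  assume "x \<in> V \<and> 5 \<le> card (N x \<inter> (W - N v)) \<and>
        g \<le> gain early_weight W v + gain early_weight (W - N v) w"
  then show ?thesis
    using bound_early[of x W v] bound_bounds(2)[of "W - N v - N w"] by (simp add: gain_def)
next
  assume a: "max_deg (W - N v) 4 \<and> g \<le> gain late_weight W v + gain late_weight (W - N v) w"
  then have "bound (W - N v - N w) = pot late_weight (W - N v - N w)"
    using bound_late max_deg_Diff by blast
  then show ?thesis using a bound_bounds(1)[of W] by (simp add: gain_def)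
qed

lemma max_deg_mono: "max_deg W j \<Longrightarrow> j \<le> k \<Longrightarrow> max_deg W k"
  by (force simp: max_deg_def)

text \<open>By decreasing maximum degree after Staller's move, the two gains are at least 16 + 56,
  16 + 56, 72 by \<open>round_deg_3\<close>, and 20 + 52. A decided position with degrees at most 2
  may admit no such reply, so only Staller's 20 is recorded.\<close>

lemma round:
  assumes W: "W \<subseteq> V" and v: "v \<in> V" "N v \<inter> W \<noteq> {}"
  shows "decided (W - N v) \<and> pot late_weight (W - N v) \<le> bound W - 20
    \<or> (\<exists>w\<in>V. N w \<inter> (W - N v) \<noteq> {} \<and> bound (W - N v - N w) \<le> bound W - 72)"
proof (cases "max_deg (W - N v) 2 \<and> decided (W - N v)")
  case True
  then show ?thesis
    using staller_gain_late_bounds(2)[OF W v] bound_bounds(1)[of W] by (simp add: gain_def)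
next
  case nd: False
  let ?W = "W - N v"
  have W1: "?W \<subseteq> V" using W by blast
  show ?thesis
  proof (cases rule: max_deg_cases[of ?W])
    case (5 x)
    then obtain w where w: "w \<in> V" "56 \<le> gain early_weight ?W w" using reply_deg_ge_5[OF W1] by blast
    then show ?thesis
      using round_bound[of x W v 72 w] 5 staller_gain_early[OF W v] gain_legal[of early_weight ?W w] by auto
  next
    case (4 x)
    then obtain w where w: "w \<in> V" "56 \<le> gain late_weight ?W w" using reply_deg_4[OF W1] by blast
    then show ?thesis
      using round_bound[of x W v 72 w] 4 staller_gain_late_bounds(1)[OF W v] gain_legal[of late_weight ?W w]
      by auto
  next
    case (3 x)
    then obtain w where w: "w \<in> V" "54 \<le> gain late_weight ?W w"
      "72 \<le> gain late_weight W v + gain late_weight ?W w" using round_deg_3[OF W v] by blast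
    then show ?thesis
      using round_bound[of x W v 72 w] max_deg_mono[OF 3(1)] gain_legal[of late_weight ?W w] by auto
  next
    case 2
    then obtain w where w: "w \<in> V" "52 \<le> gain late_weight ?W w" using reply_deg_2[OF W1] nd by blast
    then show ?thesis
      using round_bound[of w W v 72 w] max_deg_mono[OF 2] staller_gain_late_bounds(2)[OF W v 2]
        gain_legal[of late_weight ?W w] by auto
  qed
qed

lemma first_gain:
  assumes b: "admissible b" and v: "v \<in> V"
    and B: "B \<le> 20" "\<And>u. u \<in> V \<Longrightarrow> b (card (N u \<inter> (V - N v))) \<le> B"
  shows "20 + 2 * (20 - B) \<le> gain b V v"
proof -
  have "weight b V v + int (card (N v \<inter> V - {v})) * (20 - B) \<le> gain b V v"
    using B by (intro gain_ge_crude b v) auto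
  moreover have "N v \<inter> V = N v" using sub[OF v] by blast
  then have "2 \<le> card (N v \<inter> V - {v})" using card_N_ge_3[OF v] self by (simp add: card_Diff_singleton)
  then have "2 * (20 - B) \<le> int (card (N v \<inter> V - {v})) * (20 - B)"
    using B(1) by (intro mult_right_mono) auto
  ultimately show ?thesis using v by (simp add: weight_def)
qed

text \<open>All vertices are white at the start, so the first move gains more: the totals are at
  least 32 + 56, 34 + 56, 36 + 54 and 40 + 52. If the first move leads to a decided position, its
  own 36 is enough.\<close>

lemma first_round:
  assumes v: "v \<in> V"
  shows "decided (V - N v) \<and> pot late_weight (V - N v) \<le> 20 * int (card V) - 36
    \<or> (\<exists>w\<in>V. N w \<inter> (V - N v) \<noteq> {} \<and> bound (V - N v - N w) \<le> 20 * int (card V) - 88)"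
proof -
  let ?W = "V - N v"
  have W1: "?W \<subseteq> V" by blast
  have pot: "pot b V = 20 * int (card V)" for b by (simp add: pot_def weight_def)
  then have bV: "bound V = 20 * int (card V)" by (simp add: bound_def)
  have late: "20 + 2 * (20 - late_weight k) \<le> gain late_weight V v" if "max_deg ?W k" for k
    using admissible_late max_degD[OF that]
    by (intro first_gain admissible_late v) (auto simp: admissible_def mono_def intro: order_trans[of _ 14])
  show ?thesis
  proof (cases rule: max_deg_cases[of ?W])
    case (5 x)
    have "20 + 2 * (20 - 14) \<le> gain early_weight V v"
      using admissible_early by (intro first_gain admissible_early v) (auto simp: admissible_def)
    moreover obtain w where w: "w \<in> V" "56 \<le> gain early_weight ?W w" using reply_deg_ge_5[OF W1] 5 by blast
    ultimately show ?thesis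
      using round_bound[of x V v 88 w] 5 bV gain_legal[of early_weight ?W w] by auto
  next
    case (4 x)
    then obtain w where w: "w \<in> V" "56 \<le> gain late_weight ?W w" using reply_deg_4[OF W1] by blast
    then show ?thesis
      using round_bound[of x V v 88 w] 4(1) late[OF 4(1)] bV gain_legal[of late_weight ?W w]
      by (auto simp: late_weight_def[of 4])
  next
    case (3 x)
    then obtain w where w: "w \<in> V" "54 \<le> gain late_weight ?W w"
      using round_deg_3[of V v] v self by blast
    then show ?thesis
      using round_bound[of x V v 88 w] max_deg_mono[OF 3(1)] late[OF 3(1)] bV gain_legal[of late_weight ?W w]
      by (auto simp: late_weight_def[of 3])
  next
    case 2
    show ?thesis
    proof (cases "decided ?W")
      case True
      then show ?thesis using late[OF 2] pot by (simp add: gain_def late_weight_def)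
    next
      case False
      then obtain w where w: "w \<in> V" "52 \<le> gain late_weight ?W w" using reply_deg_2[OF W1 2] by blast
      then show ?thesis
        using round_bound[of w V v 88 w] max_deg_mono[OF 2] late[OF 2] bV gain_legal[of late_weight ?W w]
        by (auto simp: late_weight_def[of 2])
    qed
  qed
qed

end

section \<open>From the potential to the value of the game\<close>

lemma game_val_Dominator_le:
  assumes "finite V" "v \<in> V" "\<not> cnbhd E v \<subseteq> S"
  shows "game_val V E (Suc k) True S \<le> 1 + game_val V E k False (S \<union> cnbhd E v)"
proof (cases "V \<subseteq> S")
  case False
  have "Min {1 + game_val V E k False (S \<union> cnbhd E v) | v. v \<in> V \<and> \<not> cnbhd E v \<subseteq> S}
      \<le> 1 + game_val V E k False (S \<union> cnbhd E v)"
    using assms by (intro Min_le) auto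
  then show ?thesis using False by simp
qed simp

lemma game_val_Staller_cases:
  assumes "finite V"
  obtains "game_val V E (Suc k) False S = 0"
  | v where "v \<in> V" "\<not> cnbhd E v \<subseteq> S"
      "game_val V E (Suc k) False S = 1 + game_val V E k True (S \<union> cnbhd E v)"
proof (cases "V \<subseteq> S")
  case False
  let ?M = "{1 + game_val V E k True (S \<union> cnbhd E v) | v. v \<in> V \<and> \<not> cnbhd E v \<subseteq> S}"
  obtain x where "x \<in> V" "x \<notin> S" using False by blast
  moreover have "x \<in> cnbhd E x" by (simp add: cnbhd_def)
  ultimately have "?M \<noteq> {}" by blast
  then have "Max ?M \<in> ?M" using assms by (intro Max_in) auto
  moreover have "game_val V E (Suc k) False S = Max ?M" using False by simp
  ultimately show ?thesis using that(2) by force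
qed (use that(1) in simp)

locale domination_game = triangle_nbhd V "cnbhd E" for V :: "'a set" and E
begin

lemma legal_iff: "v \<in> V \<Longrightarrow> \<not> cnbhd E v \<subseteq> S \<longleftrightarrow> cnbhd E v \<inter> (V - S) \<noteq> {}"
  using sub by blast

lemma Diff_move: "V - (S \<union> cnbhd E v) = V - S - cnbhd E v"
  by blast

text \<open>Every legal move gains at least 36 and keeps the position decided, so Dominator may
  reply arbitrarily and the turn does not matter.\<close>

lemma game_val_decided:
  "decided (V - S) \<Longrightarrow> 36 * int (game_val V E k t S) \<le> pot late_weight (V - S)"
proof (induction k arbitrary: t S)
  case 0
  then show ?case by (simp add: pot_late_nonneg)
next
  case (Suc k)
  have move: "36 * int (1 + game_val V E k t' (S \<union> cnbhd E v)) \<le> pot late_weight (V - S)"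
    if v: "v \<in> V" "\<not> cnbhd E v \<subseteq> S" for v t'
  proof -
    have "36 * int (game_val V E k t' (S \<union> cnbhd E v)) \<le> pot late_weight (V - S - cnbhd E v)"
      using Suc.IH[of "S \<union> cnbhd E v" t'] decided_Diff[OF Suc.prems] by (simp add: Diff_move)
    moreover have "36 \<le> gain late_weight (V - S) v"
      using decided_gain[of "V - S" v] Suc.prems v legal_iff by blast
    ultimately show ?thesis by (simp add: gain_def)
  qed
  show ?case
  proof (cases t)
    case True
    show ?thesis
    proof (cases "V \<subseteq> S")
      case False
      then obtain v where "v \<in> V" "\<not> cnbhd E v \<subseteq> S" using self by blast
      then show ?thesis
        using move[of v False] game_val_Dominator_le[OF fin, of v E S k] True by force
    qed (simp add: pot_late_nonneg)
  next
    case False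
    show ?thesis
      by (rule game_val_Staller_cases[OF fin, of E k S]) (use False move[of _ True] pot_late_nonneg in auto)
  qed
qed

text \<open>The slack 16 pays for the one Staller move that enters a decided position with a gain of
  20 instead of 36.\<close>

lemma game_val_le_bound:
  "36 * int (game_val V E k False S) \<le> bound (V - S) + 16"
\<comment> \<open>Strong induction, because a round uses two units of fuel.\<close>
proof (induction k arbitrary: S rule: less_induct)
  case (less k)
  have nonneg: "0 \<le> bound W" for W using bound_bounds(1) pot_late_nonneg order_trans by blast
  show ?case
  proof (cases k)
    case 0
    then show ?thesis using nonneg[of "V - S"] by simp
  next
    case (Suc j)
    show ?thesis
    proof (rule game_val_Staller_cases[OF fin, of E j S])
      assume "game_val V E (Suc j) False S = 0"
      then show ?thesis using Suc nonneg[of "V - S"] by simp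
    next
      fix v
      assume v: "v \<in> V" "\<not> cnbhd E v \<subseteq> S"
        and eq: "game_val V E (Suc j) False S = 1 + game_val V E j True (S \<union> cnbhd E v)"
      let ?S = "S \<union> cnbhd E v"
      from round[of "V - S" v] v legal_iff
      consider (d) "decided (V - ?S)" "pot late_weight (V - ?S) \<le> bound (V - S) - 20"
        | (w) w where "w \<in> V" "\<not> cnbhd E w \<subseteq> ?S" "bound (V - (?S \<union> cnbhd E w)) \<le> bound (V - S) - 72"
        by (auto simp only: Diff_move)
      then show ?thesis
      proof cases
        case d
        then show ?thesis using game_val_decided[OF d(1), of j True] Suc eq by simp
      next
        case w
        show ?thesis
        proof (cases j)
          \<comment> \<open>The fuel ends after Staller's move; its cost 36 is covered because a
            bound that drops by 72 and stays nonnegative is at least 72.\<close>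
          case 0
          then show ?thesis using Suc eq w nonneg[of "V - (?S \<union> cnbhd E w)"] by simp
        next
          case (Suc i)
          then have "game_val V E j True ?S \<le> 1 + game_val V E i False (?S \<union> cnbhd E w)"
            using game_val_Dominator_le[OF fin w(1,2)] by blast
          moreover have "36 * int (game_val V E i False (?S \<union> cnbhd E w))
              \<le> bound (V - (?S \<union> cnbhd E w)) + 16"
            using less.IH[of i] Suc \<open>k = Suc j\<close> by simp
          ultimately show ?thesis using \<open>k = Suc j\<close> eq w(3) by simp
        qed
      qed
    qed
  qed
qed

text \<open>The first round gains 88 where two moves cost 72; the surplus is exactly the slack 16 of
  \<open>game_val_le_bound\<close>.\<close>

lemma game_dom_S_le: "36 * int (game_dom_S V E) \<le> 20 * int (card V)"
proof (cases "card V")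
  case 0
  then show ?thesis by (simp add: game_dom_S_def)
next
  case (Suc j)
  show ?thesis
  proof (rule game_val_Staller_cases[OF fin, of E j "{}"])
    assume "game_val V E (Suc j) False {} = 0"
    then show ?thesis using Suc by (simp add: game_dom_S_def)
  next
    fix v
    assume v: "v \<in> V" "\<not> cnbhd E v \<subseteq> {}"
      and eq: "game_val V E (Suc j) False {} = 1 + game_val V E j True ({} \<union> cnbhd E v)"
    let ?S = "cnbhd E v"
    from first_round[OF v(1)] legal_iff
    consider (d) "decided (V - ?S)" "pot late_weight (V - ?S) \<le> 20 * int (card V) - 36"
      | (w) w where "w \<in> V" "\<not> cnbhd E w \<subseteq> ?S" "bound (V - (?S \<union> cnbhd E w)) \<le> 20 * int (card V) - 88"
      by (auto simp only: Diff_move)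
    then show ?thesis
    proof cases
      case d
      then show ?thesis using game_val_decided[OF d(1), of j True] Suc eq by (simp add: game_dom_S_def)
    next
      case w
      have "0 \<le> bound (V - (?S \<union> cnbhd E w))" using bound_bounds(1) pot_late_nonneg order_trans by blast
      moreover have "36 * int (game_val V E j True ?S) \<le> 36 + bound (V - (?S \<union> cnbhd E w)) + 16"
      proof (cases j)
        case 0
        then show ?thesis using calculation by simp
      next
        case (Suc i)
        have "game_val V E j True ?S \<le> 1 + game_val V E i False (?S \<union> cnbhd E w)"
          using game_val_Dominator_le[OF fin w(1,2)] Suc by blast
        then show ?thesis using game_val_le_bound[of i "?S \<union> cnbhd E w"] by linarith
      qed
      ultimately show ?thesis using w(3) Suc eq by (simp add: game_dom_S_def)
    qed
  qed
qed

lemma game_dom_S_le_real: "real (game_dom_S V E) \<le> 5 / 9 * real (card V)"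
  using game_dom_S_le by linarith

end

section \<open>Uniform hypergraphs and graphs covered by triangles\<close>

lemma cnbhd_iff: "u \<in> cnbhd E v \<longleftrightarrow> u = v \<or> (\<exists>e\<in>E. v \<in> e \<and> u \<in> e)"
  by (auto simp: cnbhd_def)

lemma domination_gameI:
  assumes H: "hypergraph V E"
    and nbr: "\<And>v. v \<in> V \<Longrightarrow> \<exists>u\<in>cnbhd E v. u \<noteq> v"
    and tri: "\<And>e u v. e \<in> E \<Longrightarrow> u \<in> e \<Longrightarrow> v \<in> e \<Longrightarrow> u \<noteq> v \<Longrightarrow>
      \<exists>r. r \<in> cnbhd E u \<and> r \<in> cnbhd E v \<and> r \<noteq> u \<and> r \<noteq> v"
  shows "domination_game V E"
proof
  show "finite V" using H by (simp add: hypergraph_def)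
  show "cnbhd E v \<subseteq> V" if "v \<in> V" for v using H that by (auto simp: hypergraph_def cnbhd_def)
  show "\<exists>r. r \<in> cnbhd E u \<and> r \<in> cnbhd E v \<and> r \<noteq> u \<and> r \<noteq> v"
    if "v \<in> V" "u \<in> cnbhd E v" "u \<noteq> v" for u v
    using that tri by (auto simp: cnbhd_iff)
qed (use nbr in \<open>auto simp: cnbhd_iff\<close>)

theorem theorem4:
  shows "(\<forall>(V::'a set) E. hypergraph V E \<and> uniform 3 E \<and> no_isolated V E \<longrightarrow>
            real (game_dom_S V E) \<le> 5 / 9 * real (card V))
       \<and> (\<forall>(V::'a set) E. graph V E \<and> no_isolated V E \<and> every_edge_in_triangle E \<longrightarrow>
            real (game_dom_S V E) \<le> 5 / 9 * real (card V))"
proof (intro conjI allI impI; elim conjE)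
  fix V :: "'a set" and E
  assume H: "hypergraph V E" and unif: "uniform 3 E" and iso: "no_isolated V E"
  have third: "\<exists>x y. e = {v, x, y} \<and> x \<noteq> v \<and> y \<noteq> v \<and> x \<noteq> y" if "e \<in> E" "v \<in> e" for e v
  proof -
    have "card e = 3" using unif that(1) by (simp add: uniform_def)
    then show ?thesis using that(2) by (rule obtain_three_distinct) blast
  qed
  have "domination_game V E"
  proof (rule domination_gameI[OF H])
    fix v assume "v \<in> V"
    then obtain e where e: "e \<in> E" "v \<in> e" using iso by (auto simp: no_isolated_def)
    then obtain x where "x \<in> e" "x \<noteq> v" using third[OF e] by blast
    moreover from this have "x \<in> cnbhd E v" using e by (auto simp: cnbhd_iff)
    ultimately show "\<exists>u\<in>cnbhd E v. u \<noteq> v" by blast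
  next
    fix e u v assume e: "e \<in> E" "u \<in> e" "v \<in> e" "u \<noteq> v"
    then obtain r where "r \<in> e" "r \<noteq> u" "r \<noteq> v" using third[OF e(1,3)] by blast
    then show "\<exists>r. r \<in> cnbhd E u \<and> r \<in> cnbhd E v \<and> r \<noteq> u \<and> r \<noteq> v"
      using e by (auto simp: cnbhd_iff)
  qed
  then show "real (game_dom_S V E) \<le> 5 / 9 * real (card V)"
    by (rule domination_game.game_dom_S_le_real)
next
  fix V :: "'a set" and E
  assume G: "graph V E" and iso: "no_isolated V E" and tri: "every_edge_in_triangle E"
  have two: "card e = 2" if "e \<in> E" for e using G that by (simp add: graph_def uniform_def)
  have "domination_game V E"
  proof (rule domination_gameI)
    show "hypergraph V E" using G by (simp add: graph_def)
  next
    fix v assume "v \<in> V"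
    then obtain e where e: "e \<in> E" "v \<in> e" using iso by (auto simp: no_isolated_def)
    then obtain u where "u \<in> e" "u \<noteq> v" using two[OF e(1)] by (auto simp: card_2_iff)
    moreover from this have "u \<in> cnbhd E v" using e by (auto simp: cnbhd_iff)
    ultimately show "\<exists>u\<in>cnbhd E v. u \<noteq> v" by blast
  next
    fix e u v assume e: "e \<in> E" "u \<in> e" "v \<in> e" "u \<noteq> v"
    obtain x y z where xyz: "e = {x, y}" "{x, z} \<in> E" "{y, z} \<in> E"
      using tri e(1) by (auto simp: every_edge_in_triangle_def)
    \<comment> \<open>That \<open>z\<close> is a third vertex follows from the edges
      \<open>{x, z}\<close> and \<open>{y, z}\<close> having two elements; the definition of
      \<open>every_edge_in_triangle\<close> does not state it.\<close>
    then have "z \<noteq> x" "z \<noteq> y" using two[of "{x, z}"] two[of "{y, z}"] by auto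
    moreover have "z \<in> cnbhd E x" "z \<in> cnbhd E y" using xyz by (auto simp: cnbhd_iff)
    moreover have "u = x \<and> v = y \<or> u = y \<and> v = x" using xyz e by auto
    ultimately show "\<exists>r. r \<in> cnbhd E u \<and> r \<in> cnbhd E v \<and> r \<noteq> u \<and> r \<noteq> v" by blast
  qed
  then show "real (game_dom_S V E) \<le> 5 / 9 * real (card V)"
    by (rule domination_game.game_dom_S_le_real)
qed

end
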